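(* Let $k\ge 2$ be a fixed integer. For each integer $n\ge k$, let $(x_m)_{m\ge 0}$ be the repeated $k$-averages Markov chain on $\mathbb{R}^n$ started from $x_0=(1,0,\dots,0)\in\mathbb{R}^n$, and let $T(m)=\sum_{i=1}^n |x_{m,i}-\bar{x}_0|$ for integers $m\ge 0$, with $T(t):=T(\lfloor t\rfloor)$ for real $t\ge 0$. Then, as $n\to\infty$ (with $k$ and $\theta$ fixed): (i) for every real $\theta$ with $0\le\theta<\frac{1}{k\log k}$, $T(\theta n\log n)\to 2$ in probability; (ii) for every real $\theta>\frac{1}{k-1}$, $T(\theta n\log n)\to 0$ in probability.
   Context: Repeated $k$-averages Markov chain on $\mathbb{R}^n$: start from a fixed (deterministic) vector $x_0=(x_{0,1},\dots,x_{0,n})\in\mathbb{R}^n$. At each stage $m\ge 0$, given $x_m=(x_{m,1},\dots,x_{m,n})$, pick $k$ distinct indices $I_1,\dots,I_k\in\{1,\dots,n\}$ uniformly at random without replacement, independently of all previous choices. Then $x_{m+1}$ is obtained from $x_m$ by replacing each of the coordinates $x_{m,I_1},\dots,x_{m,I_k}$ by their average $(x_{m,I_1}+\dots+x_{m,I_k})/k$, leaving all other coordinates unchanged. The notation $\bar{x}_0=\frac1n\sum_{i=1}^n x_{0,i}$ denotes the average of the initial vector (so $\bar{x}_0=1/n$ for $x_0=(1,0,\dots,0)$). The logarithm is the natural logarithm. *)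

theory Defs
  imports "HOL-Probability.Probability"
begin

text \<open>
  Vectors of length \<open>n\<close> are functions \<open>nat \<Rightarrow> real\<close> of which only the coordinates \<open>1, \<dots>, n\<close> matter,
  since \<open>n\<close> varies within one statement.
\<close>

definition index_tuples :: "nat \<Rightarrow> nat \<Rightarrow> nat list set" where
  "index_tuples n k = {is. length is = k \<and> distinct is \<and> set is \<subseteq> {1..n}}"

definition average_at :: "nat list \<Rightarrow> (nat \<Rightarrow> real) \<Rightarrow> nat \<Rightarrow> real" where
  "average_at is x = (\<lambda>i. if i \<in> set is then (\<Sum>j\<leftarrow>is. x j) / real (length is) else x i)"

text \<open>
  The randomness of the repeated \<open>k\<close>-averages chain on a probability space \<open>M\<close>: the tuple
  \<open>(I\<^sub>1, \<dots>, I\<^sub>k)\<close> picked at stage \<open>m\<close> is the random variable \<open>I m\<close>. Measurability of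
  each \<open>I m\<close> is part of \<open>indep_vars\<close>. The uniform distribution is only meaningful for
  \<open>k \<le> n\<close>, when \<open>index_tuples n k\<close> is nonempty.
\<close>

locale k_averages_choices = prob_space M
  for M :: "'a measure" +
  fixes n k :: nat
    and I :: "nat \<Rightarrow> 'a \<Rightarrow> nat list"
  assumes indep_choices: "indep_vars (\<lambda>_. count_space UNIV) I UNIV"
    and uniform_choice:
      "\<And>m. distr M (count_space UNIV) (I m) = measure_pmf (pmf_of_set (index_tuples n k))"

text \<open>The locale is inhabited, by the coordinate projections of an infinite product space.\<close>

lemma k_averages_choices_exists:
  "\<exists>(M :: (nat \<Rightarrow> nat list) measure) I. k_averages_choices M n k I"
proof -
  let ?P = "measure_pmf (pmf_of_set (index_tuples n k))"
  let ?M = "PiM (UNIV :: nat set) (\<lambda>_. ?P)"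
  interpret product_prob_space "\<lambda>_::nat. ?P" UNIV
    by unfold_locales
  have sts: "sets (PiM UNIV (\<lambda>_::nat. count_space (UNIV :: nat list set))) = sets ?M"
    by (intro sets_PiM_cong) auto
  have "distr ?M (PiM UNIV (\<lambda>_. count_space UNIV)) (\<lambda>\<omega>. \<lambda>m\<in>UNIV. \<omega> m) = distr ?M ?M (\<lambda>\<omega>. \<omega>)"
    by (rule distr_cong) (use sts in auto)
  hence id: "distr ?M (PiM UNIV (\<lambda>_. count_space UNIV)) (\<lambda>\<omega>. \<lambda>m\<in>UNIV. \<omega> m) = ?M"
    by simp
  have comp: "distr ?M (count_space UNIV) (\<lambda>\<omega>. \<omega> m) = ?P" for m
  proof -
    have "distr ?M (count_space UNIV) (\<lambda>\<omega>. \<omega> m) = distr ?M ?P (\<lambda>\<omega>. \<omega> m)"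
      by (rule distr_cong) auto
    thus ?thesis using PiM_component[of m] by simp
  qed
  have meas: "(\<lambda>\<omega>. \<omega> m) \<in> measurable ?M (count_space UNIV)" for m
    using measurable_component_singleton[of m UNIV "\<lambda>_. ?P"] by simp
  have "indep_vars (\<lambda>_. count_space UNIV) (\<lambda>m \<omega>. \<omega> m) (UNIV::nat set)"
    by (subst indep_vars_iff_distr_eq_PiM') (use comp id meas in simp_all)
  hence "k_averages_choices ?M n k (\<lambda>m \<omega>. \<omega> m)"
    using comp by unfold_locales
  thus ?thesis by blast
qed

primrec averages_chain ::
    "(nat \<Rightarrow> real) \<Rightarrow> (nat \<Rightarrow> 'a \<Rightarrow> nat list) \<Rightarrow> nat \<Rightarrow> 'a \<Rightarrow> nat \<Rightarrow> real" where
  "averages_chain x0 I 0 \<omega> = x0"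
| "averages_chain x0 I (Suc m) \<omega> = average_at (I m \<omega>) (averages_chain x0 I m \<omega>)"

definition vec_mean :: "nat \<Rightarrow> (nat \<Rightarrow> real) \<Rightarrow> real" where
  "vec_mean n x = (\<Sum>i=1..n. x i) / real n"

definition l1_deviation ::
    "nat \<Rightarrow> (nat \<Rightarrow> real) \<Rightarrow> (nat \<Rightarrow> 'a \<Rightarrow> nat list) \<Rightarrow> nat \<Rightarrow> 'a \<Rightarrow> real" where
  "l1_deviation n x0 I m \<omega> = (\<Sum>i=1..n. \<bar>averages_chain x0 I m \<omega> i - vec_mean n x0\<bar>)"

definition first_unit_vec :: "nat \<Rightarrow> real" where
  "first_unit_vec = (\<lambda>i. if i = 1 then 1 else 0)"

text \<open>
  Convergence in probability to a constant; the \<open>n\<close>-th variable may live on its own probability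
  space \<open>M n\<close>.
\<close>

definition tendsto_in_prob :: "(nat \<Rightarrow> 'a measure) \<Rightarrow> (nat \<Rightarrow> 'a \<Rightarrow> real) \<Rightarrow> real \<Rightarrow> bool" where
  "tendsto_in_prob M X c \<longleftrightarrow>
    (\<forall>\<epsilon>>0. (\<lambda>n. measure (M n) {\<omega> \<in> space (M n). \<bar>X n \<omega> - c\<bar> > \<epsilon>}) \<longlonglongrightarrow> 0)"

end

theory Submission
  imports Defs
begin

text \<open>
  Both halves are first-moment arguments: a nonnegative function \<open>F\<close> of the state is multiplied, in
  expectation over one step, by at most a constant \<open>c\<close>, so that after \<open>m\<close> steps its expectation is at
  most \<open>c ^ m\<close> times its initial value, and Markov's inequality turns this into a tail bound
  (\<open>prob_chain_tail\<close>). Only the function differs.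

  \<^item> For \<open>\<theta> > 1 / (k - 1)\<close> it is the sum of squares \<open>\<Sum>(x i - \<mu>)\<^sup>2\<close> around the mean, which is multiplied
  by exactly \<open>1 - (k - 1) / (n - 1)\<close> (\<open>sum_average_at_variance\<close>). By Cauchy--Schwarz the square of the
  \<open>l1\<close> deviation is at most \<open>n\<close> times this sum, and after \<open>\<theta> n log n\<close> steps
  \<open>n * exp (- (k - 1) * \<theta> * log n)\<close> tends to \<open>0\<close>.

  \<^item> For \<open>\<theta> < 1 / (k log k)\<close> it is \<open>\<Sum>x i powr (1 - s)\<close> with a small \<open>s > 0\<close>. A unit of mass travelling
  with the averages is touched in one step with probability \<open>k / n\<close>, and the height of the pile it belongs
  to then falls at most by the factor \<open>k\<close>. Weighting each unit of mass by the power \<open>- s\<close> of the height of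
  its pile, one obtains a growth factor of at most \<open>1 + (k / n) * (k powr s - 1)\<close>
  (\<open>sum_average_at_powr_growth\<close>). The \<open>l1\<close> distance of a probability vector from the uniform one falls
  short of \<open>2\<close> by \<open>2 * \<Sum>min (x i) (1 / n)\<close>, and \<open>min a b \<le> a powr (1 - s) * b powr s\<close> bounds this by
  \<open>2 * n powr (- s) * \<Sum>x i powr (1 - s)\<close> (\<open>l1_dist_uniform\<close>). After \<open>\<theta> n log n\<close> steps the expectation of
  that bound is at most \<open>2 * n powr (\<theta> * k * (k powr s - 1) - s)\<close>, and since \<open>(k powr s - 1) / s\<close> tends
  to \<open>log k\<close> as \<open>s\<close> tends to \<open>0\<close>, the exponent is negative for small \<open>s\<close> exactly when
  \<open>\<theta> * k * log k < 1\<close>.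
\<close>

section \<open>The law of the chain\<close>

context k_averages_choices
begin

lemma measurable_choice: "I m \<in> measurable M (count_space UNIV)"
  using indep_choices by (auto simp: indep_vars_def)

lemma prob_choice: "prob (I m -` {J} \<inter> space M) = pmf (pmf_of_set (index_tuples n k)) J"
proof -
  have "measure (distr M (count_space UNIV) (I m)) {J} = prob (I m -` {J} \<inter> space M)"
    by (rule measure_distr[OF measurable_choice]) auto
  then show ?thesis
    by (simp add: uniform_choice measure_pmf_single)
qed

lemma choices_fiber:
  "(\<lambda>\<omega>. map (\<lambda>i. I i \<omega>) [0..<m]) -` {hs} \<inter> space M =
     (if length hs = m then {\<omega>\<in>space M. \<forall>i\<in>{..<m}. I i \<omega> = hs ! i} else {})"
  by (auto simp: list_eq_iff_nth_eq[of "map f xs" for f xs])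

lemma measurable_choices: "(\<lambda>\<omega>. map (\<lambda>i. I i \<omega>) [0..<m]) \<in> measurable M (count_space UNIV)"
proof -
  have "{\<omega>\<in>space M. I i \<omega> = J} \<in> sets M" for i J
    using measurable_sets[OF measurable_choice, of "{J}" i] by (simp add: vimage_def Int_def conj_commute)
  then have "(\<lambda>\<omega>. map (\<lambda>i. I i \<omega>) [0..<m]) -` {hs} \<inter> space M \<in> sets M" for hs
    unfolding choices_fiber by (auto intro: sets.sets_Collect_finite_All)
  then show ?thesis
    by (subst measurable_count_space_eq_countable) simp_all
qed

text \<open>
  Both sides are measures on a countable type, so it is enough to compare their values at single lists,
  where independence makes either one a product.
\<close>

lemma distr_choices:
  "distr M (count_space UNIV) (\<lambda>\<omega>. map (\<lambda>i. I i \<omega>) [0..<m])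
     = measure_pmf (replicate_pmf m (pmf_of_set (index_tuples n k)))"
proof -
  let ?p = "pmf_of_set (index_tuples n k)"
  let ?H = "\<lambda>\<omega>. map (\<lambda>i. I i \<omega>) [0..<m]"
  have "prob (?H -` {hs} \<inter> space M) = pmf (replicate_pmf m ?p) hs" for hs
  proof (cases "length hs = m")
    case False
    then have "hs \<notin> set_pmf (replicate_pmf m ?p)"
      by (auto simp: set_replicate_pmf)
    then show ?thesis
      unfolding choices_fiber using False by (simp add: set_pmf_iff)
  next
    case True
    (* A list of independent draws is a pair of its head and its tail, read through Cons. *)
    have replicate: "pmf (replicate_pmf (length xs) ?p) xs = prod_list (map (pmf ?p) xs)" for xs
    proof (induction xs)
      case (Cons x xs)
      have "pmf (replicate_pmf (length (x # xs)) ?p) (x # xs)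
          = pmf (map_pmf (\<lambda>(y, ys). y # ys) (pair_pmf ?p (replicate_pmf (length xs) ?p)))
              ((\<lambda>(y, ys). y # ys) (x, xs))"
        by (simp add: pair_pmf_def map_bind_pmf)
      also have "\<dots> = pmf (pair_pmf ?p (replicate_pmf (length xs) ?p)) (x, xs)"
        by (rule pmf_map_inj') (auto simp: inj_def)
      finally show ?case
        using Cons by (simp add: pmf_pair)
    qed simp
    show ?thesis
    proof (cases "m = 0")
      case True
      with \<open>length hs = m\<close> show ?thesis by (simp add: prob_space)
    next
      case False
      have "?H -` {hs} \<inter> space M = (\<Inter>i\<in>{..<m}. I i -` {hs ! i} \<inter> space M)"
        unfolding choices_fiber using True False by auto
      also have "prob \<dots> = (\<Prod>i\<in>{..<m}. prob (I i -` {hs ! i} \<inter> space M))"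
        by (rule indep_varsD[OF indep_choices]) (use False in auto)
      also have "\<dots> = prod_list (map (pmf ?p) hs)"
        using True by (simp add: prob_choice prod.list_conv_set_nth atLeast0LessThan)
      finally show ?thesis
        using replicate[of hs] True by simp
    qed
  qed
  then have "emeasure (distr M (count_space UNIV) ?H) {hs}
      = emeasure (measure_pmf (replicate_pmf m ?p)) {hs}" for hs
    by (simp add: emeasure_distr[OF measurable_choices] emeasure_eq_measure emeasure_pmf_single)
  then show ?thesis
    by (intro measure_eqI_countable[where A=UNIV]) auto
qed

lemma averages_chain_eq_fold:
  "averages_chain x0 I m \<omega> = fold average_at (map (\<lambda>i. I i \<omega>) [0..<m]) x0"
  by (induction m) auto

text \<open>
  From here on the probability space is out of the way: events about the chain are events about a list of
  independent uniform tuples, on which one can argue by induction.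
\<close>

lemma prob_chain:
  "prob {\<omega>\<in>space M. Q (averages_chain x0 I m \<omega>)}
     = measure_pmf.prob (replicate_pmf m (pmf_of_set (index_tuples n k)))
         {Js. Q (fold average_at Js x0)}"
proof -
  have "measure (distr M (count_space UNIV) (\<lambda>\<omega>. map (\<lambda>i. I i \<omega>) [0..<m]))
          {Js. Q (fold average_at Js x0)}
      = prob ((\<lambda>\<omega>. map (\<lambda>i. I i \<omega>) [0..<m]) -` {Js. Q (fold average_at Js x0)} \<inter> space M)"
    by (rule measure_distr[OF measurable_choices]) auto
  then show ?thesis
    by (simp add: distr_choices averages_chain_eq_fold vimage_def Int_def conj_commute)
qed

end

section \<open>Uniform index tuples\<close>

lemma finite_index_tuples: "finite (index_tuples n k)"
  by (rule finite_subset[OF _ finite_lists_length_eq[OF finite_atLeastAtMost, of 1 n k]])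
     (auto simp: index_tuples_def)

lemma index_tuples_nonempty: "k \<le> n \<Longrightarrow> index_tuples n k \<noteq> {}"
  unfolding index_tuples_def ex_in_conv[symmetric] by (rule exI[of _ "[1..<Suc k]"]) auto

lemma index_tuplesD:
  assumes "J \<in> index_tuples n k"
  shows "length J = k" "distinct J" "set J \<subseteq> {1..n}" "card (set J) = k"
  using assms by (auto simp: index_tuples_def distinct_card)

lemma map_permutes_index_tuples:
  assumes "\<pi> permutes {1..n}" "J \<in> index_tuples n k"
  shows "map \<pi> J \<in> index_tuples n k"
  using assms permutes_in_image[OF assms(1)]
  by (auto simp: index_tuples_def distinct_map intro: inj_on_subset[OF permutes_inj])

lemma sum_index_tuples_permute:
  assumes "\<pi> permutes {1..n}"
  shows "(\<Sum>J\<in>index_tuples n k. f (map \<pi> J)) = (\<Sum>J\<in>index_tuples n k. f J)"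
  by (rule sum.reindex_bij_witness[where j="map \<pi>" and i="map (inv \<pi>)"])
     (use assms in \<open>auto simp: map_permutes_index_tuples permutes_inv o_def map_idI
        permutes_inverses[OF assms]\<close>)

lemma sum_subset_of_bool:
  fixes g :: "'b \<Rightarrow> real"
  assumes "finite B" "A \<subseteq> B"
  shows "sum g A = (\<Sum>i\<in>B. of_bool (i \<in> A) * g i)"
proof -
  have "(\<Sum>i\<in>B. of_bool (i \<in> A) * g i) = (\<Sum>i\<in>A. of_bool (i \<in> A) * g i)"
    by (rule sum.mono_neutral_right) (use assms in auto)
  then show ?thesis by simp
qed

text \<open>
  Each index lies in the same number \<open>w 1\<close> of tuples, because a transposition moves it to \<open>1\<close>. The value of
  \<open>w 1\<close> needs no counting of tuples: it comes from the same identity applied to the constant function.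
\<close>

lemma sum_index_tuples_single:
  fixes g :: "nat \<Rightarrow> real"
  shows "real n * (\<Sum>J\<in>index_tuples n k. \<Sum>j\<in>set J. g j)
       = real k * card (index_tuples n k) * (\<Sum>i=1..n. g i)"
proof -
  let ?T = "index_tuples n k"
  define w where "w i = (\<Sum>J\<in>?T. of_bool (i \<in> set J) :: real)" for i
  have expand: "(\<Sum>J\<in>?T. \<Sum>j\<in>set J. g j) = (\<Sum>i=1..n. w i * g i)" for g
  proof -
    have "(\<Sum>J\<in>?T. \<Sum>j\<in>set J. g j) = (\<Sum>J\<in>?T. \<Sum>i=1..n. of_bool (i \<in> set J) * g i)"
      by (intro sum.cong refl sum_subset_of_bool) (auto simp: index_tuples_def)
    then show ?thesis
      by (subst (asm) sum.swap) (simp add: w_def sum_distrib_right)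
  qed
  have const: "w i = w 1" if "i \<in> {1..n}" for i
  proof -
    have perm: "Transposition.transpose 1 i permutes {1..n}"
      using that by (intro permutes_swap_id) auto
    have "Transposition.transpose 1 i 1 = i" by simp
    then have mem: "i \<in> Transposition.transpose 1 i ` A \<longleftrightarrow> 1 \<in> A" for A
      using inj_image_mem_iff[OF permutes_inj[OF perm], of 1 A] by metis
    have "w 1 = (\<Sum>J\<in>?T. of_bool (i \<in> set (map (Transposition.transpose 1 i) J)))"
      unfolding w_def set_map mem ..
    also have "\<dots> = w i"
      unfolding w_def by (rule sum_index_tuples_permute[OF perm])
    finally show ?thesis by simp
  qed
  have eq: "(\<Sum>J\<in>?T. \<Sum>j\<in>set J. g j) = w 1 * (\<Sum>i=1..n. g i)" for g
    unfolding expand sum_distrib_left by (intro sum.cong refl arg_cong2[where f="(*)"] const)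
  have "real k * card ?T = (\<Sum>J\<in>?T. \<Sum>j\<in>set J. 1)"
    by (simp add: index_tuplesD)
  also have "\<dots> = w 1 * n"
    by (subst eq) simp
  finally show ?thesis
    by (simp add: eq algebra_simps)
qed

text \<open>
  The analogue for ordered pairs of distinct indices, which the permutations of \<open>{1..n}\<close> also move into one
  another; \<open>h\<close> has to vanish on the diagonal because for \<open>k < n\<close> more tuples contain an
  index paired with itself than contain two distinct ones.
\<close>

lemma sum_index_tuples_pair:
  fixes h :: "nat \<Rightarrow> nat \<Rightarrow> real"
  assumes diag: "\<And>i. h i i = 0"
  shows "real n * (real n - 1) * (\<Sum>J\<in>index_tuples n k. \<Sum>i\<in>set J. \<Sum>j\<in>set J. h i j)
       = real k * (real k - 1) * card (index_tuples n k) * (\<Sum>i=1..n. \<Sum>j=1..n. h i j)"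
proof -
  let ?T = "index_tuples n k"
  define w where "w i j = (\<Sum>J\<in>?T. of_bool (i \<in> set J \<and> j \<in> set J) :: real)" for i j
  have expand: "(\<Sum>J\<in>?T. \<Sum>i\<in>set J. \<Sum>j\<in>set J. h i j) = (\<Sum>i=1..n. \<Sum>j=1..n. w i j * h i j)" for h
  proof -
    have "(\<Sum>J\<in>?T. \<Sum>i\<in>set J. \<Sum>j\<in>set J. h i j)
        = (\<Sum>J\<in>?T. \<Sum>i=1..n. \<Sum>j=1..n. of_bool (i \<in> set J \<and> j \<in> set J) * h i j)"
    proof (rule sum.cong[OF refl])
      fix J assume "J \<in> ?T"
      then have J: "set J \<subseteq> {1..n}" by (rule index_tuplesD)
      have "(\<Sum>i\<in>set J. \<Sum>j\<in>set J. h i j)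
          = (\<Sum>i=1..n. of_bool (i \<in> set J) * (\<Sum>j=1..n. of_bool (j \<in> set J) * h i j))"
        by (simp only: sum_subset_of_bool[OF finite_atLeastAtMost J])
      then show "(\<Sum>i\<in>set J. \<Sum>j\<in>set J. h i j)
          = (\<Sum>i=1..n. \<Sum>j=1..n. of_bool (i \<in> set J \<and> j \<in> set J) * h i j)"
        by (simp only: sum_distrib_left of_bool_conj mult.assoc)
    qed
    also have "\<dots> = (\<Sum>i=1..n. \<Sum>j=1..n. \<Sum>J\<in>?T. of_bool (i \<in> set J \<and> j \<in> set J) * h i j)"
      by (simp only: sum.swap[of _ _ ?T])
    finally show ?thesis
      by (simp add: w_def sum_distrib_right)
  qed
  have const: "w i j = w 1 2" if ij: "i \<in> {1..n}" "j \<in> {1..n}" "i \<noteq> j" for i j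
  proof -
    (* The permutation sends i to 1 first; this may displace j, and the new place of j is then sent to 2. *)
    define j' where "j' = Transposition.transpose 1 i j"
    have "n \<ge> 2" using ij by auto
    have j': "j' \<in> {1..n}" "j' \<noteq> 1"
      using ij by (auto simp: j'_def Transposition.transpose_def)
    define \<pi> where "\<pi> = Transposition.transpose 2 j' \<circ> Transposition.transpose 1 i"
    have perm: "\<pi> permutes {1..n}"
      unfolding \<pi>_def using ij j' \<open>n \<ge> 2\<close>
      by (intro permutes_compose permutes_swap_id) auto
    have "\<pi> i = Transposition.transpose 2 j' 1" "\<pi> j = Transposition.transpose 2 j' j'"
      by (simp_all add: \<pi>_def j'_def)
    then have "\<pi> i = 1" "\<pi> j = 2"
      using j' by (simp_all add: transpose_apply_other)
    then have mem: "1 \<in> \<pi> ` A \<longleftrightarrow> i \<in> A" "2 \<in> \<pi> ` A \<longleftrightarrow> j \<in> A" for A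
      using inj_image_mem_iff[OF permutes_inj[OF perm], of _ A] by metis+
    have "w i j = (\<Sum>J\<in>?T. of_bool (1 \<in> set (map \<pi> J) \<and> 2 \<in> set (map \<pi> J)))"
      unfolding w_def set_map mem ..
    also have "\<dots> = w 1 2"
      unfolding w_def by (rule sum_index_tuples_permute[OF perm])
    finally show ?thesis .
  qed
  have eq: "(\<Sum>J\<in>?T. \<Sum>i\<in>set J. \<Sum>j\<in>set J. h i j) = w 1 2 * (\<Sum>i=1..n. \<Sum>j=1..n. h i j)"
    if "\<And>i. h i i = 0" for h
  proof -
    have "w i j * h i j = w 1 2 * h i j" if "i \<in> {1..n}" "j \<in> {1..n}" for i j
      using that const[of i j] \<open>\<And>i. h i i = 0\<close> by (cases "i = j") auto
    then show ?thesis
      unfolding expand sum_distrib_left by (intro sum.cong refl)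
  qed
  have off_diagonal: "(\<Sum>i\<in>A. \<Sum>j\<in>A. of_bool (i \<noteq> j)) = real (card A) * (real (card A) - 1)"
    if "finite A" for A :: "nat set"
  proof -
    have "(\<Sum>j\<in>A. of_bool (i \<noteq> j)) = real (card A) - 1" if "i \<in> A" for i
    proof -
      have "(\<Sum>j\<in>A. of_bool (i \<noteq> j) :: real) = (\<Sum>j\<in>A. 1 - of_bool (j = i))"
        by (intro sum.cong) auto
      then show ?thesis
        using \<open>finite A\<close> that by (simp add: sum_subtractf of_bool_def)
    qed
    then show ?thesis by simp
  qed
  have "real k * (real k - 1) * card ?T = (\<Sum>J\<in>?T. \<Sum>i\<in>set J. \<Sum>j\<in>set J. of_bool (i \<noteq> j))"
  proof -
    have "(\<Sum>i\<in>set J. \<Sum>j\<in>set J. of_bool (i \<noteq> j)) = real k * (real k - 1)" if "J \<in> ?T" for J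
      using off_diagonal[of "set J"] index_tuplesD[OF that] by (simp only: finite_set)
    then have "(\<Sum>J\<in>?T. \<Sum>i\<in>set J. \<Sum>j\<in>set J. of_bool (i \<noteq> j)) = (\<Sum>J\<in>?T. real k * (real k - 1))"
      by (rule sum.cong[OF refl])
    then show ?thesis by (simp only: sum_constant mult.commute)
  qed
  also have "\<dots> = w 1 2 * (real n * (real n - 1))"
  proof -
    have "(\<Sum>i=1..n. \<Sum>j=1..n. of_bool (i \<noteq> j)) = real n * (real n - 1)"
      using off_diagonal[of "{1..n}"] by (simp only: finite_atLeastAtMost card_atLeastAtMost diff_Suc_1)
    moreover have "(\<Sum>J\<in>?T. \<Sum>i\<in>set J. \<Sum>j\<in>set J. of_bool (i \<noteq> j))
        = w 1 2 * (\<Sum>i=1..n. \<Sum>j=1..n. of_bool (i \<noteq> j))"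
      by (rule eq) simp
    ultimately show ?thesis by (simp only:)
  qed
  finally have count: "real k * (real k - 1) * card ?T = w 1 2 * (real n * (real n - 1))" .
  show ?thesis
    unfolding eq[OF diag] count by (simp only: mult_ac)
qed

lemma sum_average_at:
  fixes \<phi> :: "real \<Rightarrow> real"
  assumes "J \<in> index_tuples n k"
  shows "(\<Sum>i=1..n. \<phi> (average_at J x i))
       = (\<Sum>i=1..n. \<phi> (x i)) - (\<Sum>j\<in>set J. \<phi> (x j)) + k * \<phi> ((\<Sum>j\<in>set J. x j) / k)"
proof -
  note J = index_tuplesD[OF assms]
  have part: "sum f {1..n} = sum f ({1..n} - set J) + sum f (set J)" for f :: "nat \<Rightarrow> real"
    by (rule sum.subset_diff) (use J in auto)
  have "(\<Sum>j\<leftarrow>J. x j) = (\<Sum>j\<in>set J. x j)"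
    using J(2) by (rule sum_list_distinct_conv_sum_set)
  then have "average_at J x i = (if i \<in> set J then (\<Sum>j\<in>set J. x j) / k else x i)" for i
    by (simp add: average_at_def J)
  then have "(\<Sum>i=1..n. \<phi> (average_at J x i))
      = (\<Sum>i\<in>{1..n} - set J. \<phi> (x i)) + (\<Sum>j\<in>set J. \<phi> ((\<Sum>j\<in>set J. x j) / k))"
    by (simp add: part del: One_nat_def)
  then show ?thesis
    by (simp add: part[of "\<lambda>i. \<phi> (x i)"] J del: One_nat_def)
qed

lemma sum_average_at_preserved:
  assumes "J \<in> index_tuples n k" "k > 0"
  shows "(\<Sum>i=1..n. average_at J x i) = (\<Sum>i=1..n. x i)"
  using sum_average_at[OF assms(1), of "\<lambda>y. y" x] assms(2) by simp

section \<open>Tail bound by first-step analysis\<close>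

text \<open>
  This is Markov's inequality for \<open>F\<close> after \<open>m\<close> steps, with the iteration of the expected factor \<open>c\<close>
  built in: conditioning on the first step applies the induction hypothesis to the chain started from the
  new state, so no expectation other than the one over a single step ever appears. The invariant \<open>P\<close>
  restricts the estimate for one step to the states that the chain can reach.
\<close>

lemma replicate_pmf_fold_tail:
  fixes F :: "'s \<Rightarrow> real" and c :: real
  assumes S: "finite S" "S \<noteq> {}"
    and "c \<ge> 0"
    and inv: "\<And>x J. P x \<Longrightarrow> J \<in> S \<Longrightarrow> P (step J x)"
    and nonneg: "\<And>x. P x \<Longrightarrow> F x \<ge> 0"
    and decay: "\<And>x. P x \<Longrightarrow> (\<Sum>J\<in>S. F (step J x)) \<le> c * card S * F x"
    and bad: "\<And>x. P x \<Longrightarrow> G x \<Longrightarrow> F x \<ge> 1"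
    and "P x"
  shows "measure_pmf.prob (replicate_pmf m (pmf_of_set S)) {Js. G (fold step Js x)} \<le> c ^ m * F x"
  using \<open>P x\<close>
proof (induction m arbitrary: x)
  case 0
  then show ?case
    using nonneg[of x] bad[of x] by (simp add: indicator_def)
next
  case (Suc m)
  let ?R = "replicate_pmf m (pmf_of_set S)"
  have "card S > 0" using S by (simp add: card_gt_0_iff)
  have "emeasure (replicate_pmf (Suc m) (pmf_of_set S)) {Js. G (fold step Js x)}
      = (\<integral>\<^sup>+J. emeasure ?R {Js. G (fold step Js (step J x))} \<partial>pmf_of_set S)"
    by (simp add: map_pmf_def[symmetric] vimage_def)
  also have "\<dots> = (\<Sum>J\<in>S. emeasure ?R {Js. G (fold step Js (step J x))}) / card S"
    by (rule nn_integral_pmf_of_set) (use S in auto)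
  also have "\<dots> = ennreal ((\<Sum>J\<in>S. measure_pmf.prob ?R {Js. G (fold step Js (step J x))}) / card S)"
    using \<open>card S > 0\<close>
    by (simp add: measure_pmf.emeasure_eq_measure sum_ennreal divide_ennreal sum_nonneg
        ennreal_of_nat_eq_real_of_nat)
  finally have "measure_pmf.prob (replicate_pmf (Suc m) (pmf_of_set S)) {Js. G (fold step Js x)}
      = (\<Sum>J\<in>S. measure_pmf.prob ?R {Js. G (fold step Js (step J x))}) / card S"
    unfolding measure_pmf.emeasure_eq_measure by (subst (asm) ennreal_inj) (auto intro!: sum_nonneg divide_nonneg_nonneg)
  also have "\<dots> \<le> (\<Sum>J\<in>S. c ^ m * F (step J x)) / card S"
    by (intro divide_right_mono sum_mono Suc.IH inv Suc.prems) auto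
  also have "\<dots> = c ^ m * (\<Sum>J\<in>S. F (step J x)) / card S"
    by (simp add: sum_distrib_left)
  also have "\<dots> \<le> c ^ m * (c * card S * F x) / card S"
    using decay[OF Suc.prems] \<open>c \<ge> 0\<close> by (intro divide_right_mono mult_left_mono) auto
  also have "\<dots> = c ^ Suc m * F x"
    using \<open>card S > 0\<close> by simp
  finally show ?case .
qed

context k_averages_choices
begin

lemma prob_chain_tail:
  fixes c :: real
  assumes "k \<le> n" "c \<ge> 0"
    and "\<And>x J. P x \<Longrightarrow> J \<in> index_tuples n k \<Longrightarrow> P (average_at J x)"
    and "\<And>x. P x \<Longrightarrow> F x \<ge> 0"
    and "\<And>x. P x \<Longrightarrow> (\<Sum>J\<in>index_tuples n k. F (average_at J x)) \<le> c * card (index_tuples n k) * F x"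
    and "\<And>x. P x \<Longrightarrow> G x \<Longrightarrow> F x \<ge> 1"
    and "P x0"
  shows "prob {\<omega>\<in>space M. G (averages_chain x0 I m \<omega>)} \<le> c ^ m * F x0"
  using replicate_pmf_fold_tail[where P=P and F=F and G=G and step=average_at and c=c
      and S="index_tuples n k" and x=x0 and m=m,
      OF finite_index_tuples index_tuples_nonempty[OF assms(1)] assms(2-7)]
  by (simp only: prob_chain[of G x0 m])

end

section \<open>Decay of the variance\<close>

lemma sum_diff_squared:
  fixes x :: "'b \<Rightarrow> real"
  assumes "finite A"
  shows "(\<Sum>i\<in>A. \<Sum>j\<in>A. (x i - x j)\<^sup>2) = 2 * (card A * (\<Sum>i\<in>A. (x i)\<^sup>2) - (\<Sum>i\<in>A. x i)\<^sup>2)"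
proof -
  let ?Q = "\<Sum>i\<in>A. (x i)\<^sup>2" and ?S = "\<Sum>i\<in>A. x i"
  have "(\<Sum>i\<in>A. \<Sum>j\<in>A. (x i - x j)\<^sup>2)
      = (\<Sum>i\<in>A. \<Sum>j\<in>A. (x i)\<^sup>2) + (\<Sum>i\<in>A. \<Sum>j\<in>A. (x j)\<^sup>2) - 2 * (\<Sum>i\<in>A. \<Sum>j\<in>A. x i * x j)"
    by (simp add: power2_diff sum.distrib sum_subtractf sum_distrib_left mult.assoc)
  also have "(\<Sum>i\<in>A. \<Sum>j\<in>A. x i * x j) = ?S\<^sup>2"
    by (simp add: sum_product power2_eq_square)
  also have "(\<Sum>i\<in>A. \<Sum>j\<in>A. (x i)\<^sup>2) = card A * ?Q"
    by (simp add: sum_distrib_left)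
  finally show ?thesis by simp
qed

text \<open>
  Averaging over a tuple \<open>J\<close> reduces the sum of squares by \<open>1 / (2 * k)\<close> times the sum of the squared
  differences within \<open>J\<close>. In expectation over \<open>J\<close> these differences are a fixed fraction of all squared
  differences, and the latter add up to \<open>2 * n\<close> times the sum of squares.
\<close>

lemma sum_average_at_variance:
  fixes x :: "nat \<Rightarrow> real" and \<mu> :: real
  assumes "2 \<le> k" "k \<le> n" and mean: "(\<Sum>i=1..n. x i) = n * \<mu>"
  shows "(\<Sum>J\<in>index_tuples n k. \<Sum>i=1..n. (average_at J x i - \<mu>)\<^sup>2)
       = (1 - (real k - 1) / (real n - 1)) * card (index_tuples n k) * (\<Sum>i=1..n. (x i - \<mu>)\<^sup>2)"
proof -
  let ?T = "index_tuples n k"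
  define V where "V = (\<Sum>i=1..n. (x i - \<mu>)\<^sup>2)"
  define D where "D J = (\<Sum>i\<in>set J. \<Sum>j\<in>set J. (x i - x j)\<^sup>2)" for J
  have n: "real n > 1" and k: "real k > 1" using assms by auto
  have step: "(\<Sum>i=1..n. (average_at J x i - \<mu>)\<^sup>2) = V - D J / (2 * k)" if J: "J \<in> ?T" for J
  proof -
    have "(\<Sum>j\<in>set J. x j) / k - \<mu> = (\<Sum>j\<in>set J. x j - \<mu>) / k"
      using k index_tuplesD[OF J] by (simp add: sum_subtractf field_simps)
    moreover have "D J = (\<Sum>i\<in>set J. \<Sum>j\<in>set J. ((x i - \<mu>) - (x j - \<mu>))\<^sup>2)"
      by (simp add: D_def)
    then have "D J = 2 * (k * (\<Sum>j\<in>set J. (x j - \<mu>)\<^sup>2) - (\<Sum>j\<in>set J. x j - \<mu>)\<^sup>2)"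
      by (subst (asm) sum_diff_squared) (simp_all add: index_tuplesD[OF J])
    moreover have "(\<Sum>i=1..n. (average_at J x i - \<mu>)\<^sup>2)
        = V - (\<Sum>j\<in>set J. (x j - \<mu>)\<^sup>2) + k * ((\<Sum>j\<in>set J. x j) / k - \<mu>)\<^sup>2"
      unfolding V_def by (rule sum_average_at[OF J])
    moreover have "V - Q + k * (S / k)\<^sup>2 = V - 2 * (k * Q - S\<^sup>2) / (2 * k)" for Q S :: real
      using k by (simp add: power2_eq_square field_simps)
    ultimately show ?thesis by simp
  qed
  have "(\<Sum>i=1..n. \<Sum>j=1..n. (x i - x j)\<^sup>2) = (\<Sum>i=1..n. \<Sum>j=1..n. ((x i - \<mu>) - (x j - \<mu>))\<^sup>2)"
    by simp
  also have "\<dots> = 2 * n * V"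
    by (subst sum_diff_squared) (simp_all add: V_def sum_subtractf mean del: One_nat_def)
  finally have total: "(\<Sum>i=1..n. \<Sum>j=1..n. (x i - x j)\<^sup>2) = 2 * n * V" .
  have "n * (real n - 1) * (\<Sum>J\<in>?T. D J) = real k * (real k - 1) * card ?T * (2 * n * V)"
    using sum_index_tuples_pair[of "\<lambda>i j. (x i - x j)\<^sup>2" n k] by (simp only: D_def total) simp
  then have "(\<Sum>J\<in>?T. D J) = 2 * k * ((real k - 1) / (real n - 1) * card ?T * V)"
    using n by (simp add: divide_simps) (simp add: mult_ac)
  moreover have "(\<Sum>J\<in>?T. \<Sum>i=1..n. (average_at J x i - \<mu>)\<^sup>2) = card ?T * V - (\<Sum>J\<in>?T. D J) / (2 * k)"
    by (simp add: step sum_subtractf sum_divide_distrib del: One_nat_def)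
  ultimately have "(\<Sum>J\<in>?T. \<Sum>i=1..n. (average_at J x i - \<mu>)\<^sup>2)
      = card ?T * V - (real k - 1) / (real n - 1) * card ?T * V"
    using k by (simp only: nonzero_mult_div_cancel_left of_nat_eq_0_iff)
  then show ?thesis
    unfolding V_def[symmetric] by (simp only: left_diff_distrib mult_1 of_nat_1)
qed

section \<open>Growth of the power sum below exponent one\<close>

text \<open>
  Writing \<open>a\<close> for the average over \<open>J\<close>, the averaged coordinates contribute
  \<open>k * a powr (1 - s) = \<Sum>x j * a powr (- s)\<close>, where each unit of mass \<open>x j\<close> carries the weight
  \<open>a powr (- s)\<close>. As the other coordinates are nonnegative, \<open>a \<ge> x j / k\<close>, so that no weight grows by more
  than the factor \<open>k powr s\<close>.
\<close>

lemma sum_average_at_powr_le: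
  fixes x :: "nat \<Rightarrow> real"
  assumes J: "J \<in> index_tuples n k" and "k > 0" and s: "0 < s" "s < 1"
    and nonneg: "\<And>i. i \<in> {1..n} \<Longrightarrow> x i \<ge> 0"
  shows "(\<Sum>i=1..n. average_at J x i powr (1 - s))
       \<le> (\<Sum>i=1..n. x i powr (1 - s)) + (k powr s - 1) * (\<Sum>j\<in>set J. x j powr (1 - s))"
proof -
  define a where "a = (\<Sum>j\<in>set J. x j) / k"
  have xJ: "x j \<ge> 0" if "j \<in> set J" for j
    using nonneg index_tuplesD[OF J] that by auto
  have "k * a powr (1 - s) \<le> k powr s * (\<Sum>j\<in>set J. x j powr (1 - s))"
  proof (cases "a = 0")
    case True
    then show ?thesis by (simp add: sum_nonneg)
  next
    case False
    moreover have "a \<ge> 0"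
      using xJ by (simp add: a_def sum_nonneg)
    ultimately have "a > 0" by simp
    have "k * a powr (1 - s) = (\<Sum>j\<in>set J. x j * a powr (- s))"
    proof -
      have "k * a powr (1 - s) = k * a * a powr (- s)"
        using powr_mult_base[of a "- s"] \<open>a > 0\<close> by simp
      also have "k * a = (\<Sum>j\<in>set J. x j)"
        using \<open>k > 0\<close> by (simp add: a_def)
      finally show ?thesis by (simp only: sum_distrib_right)
    qed
    also have "\<dots> \<le> (\<Sum>j\<in>set J. k powr s * x j powr (1 - s))"
    proof (rule sum_mono)
      fix j assume j: "j \<in> set J"
      show "x j * a powr (- s) \<le> k powr s * x j powr (1 - s)"
      proof (cases "x j = 0")
        case False
        then have "x j > 0" using xJ[OF j] by simp
        have "x j \<le> (\<Sum>j\<in>set J. x j)"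
          by (rule member_le_sum) (use j xJ in auto)
        then have "x j / k \<le> a"
          by (simp add: a_def divide_right_mono)
        then have "a powr (- s) \<le> (x j / k) powr (- s)"
          using \<open>x j > 0\<close> \<open>k > 0\<close> s by (intro powr_mono2') auto
        then have "x j * a powr (- s) \<le> x j * (x j / k) powr (- s)"
          using \<open>x j > 0\<close> by simp
        also have "\<dots> = k powr s * x j powr (1 - s)"
        proof -
          have "(x j / k) powr (- s) = x j powr (- s) * k powr s"
            using \<open>x j > 0\<close> by (simp add: powr_divide powr_minus field_simps)
          then show ?thesis
            using powr_mult_base[of "x j" "- s"] \<open>x j > 0\<close> by (simp add: mult_ac)
        qed
        finally show ?thesis .
      qed simp
    qed
    finally show ?thesis by (simp add: sum_distrib_left)
  qed
  then show ?thesis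
    by (simp add: sum_average_at[OF J, of "\<lambda>y. y powr (1 - s)"] a_def[symmetric] algebra_simps
        del: One_nat_def)
qed

lemma sum_average_at_powr_growth:
  fixes x :: "nat \<Rightarrow> real"
  assumes "0 < k" "k \<le> n" and s: "0 < s" "s < 1"
    and nonneg: "\<And>i. i \<in> {1..n} \<Longrightarrow> x i \<ge> 0"
  shows "(\<Sum>J\<in>index_tuples n k. \<Sum>i=1..n. average_at J x i powr (1 - s))
       \<le> (1 + k / n * (k powr s - 1)) * card (index_tuples n k) * (\<Sum>i=1..n. x i powr (1 - s))"
proof -
  let ?T = "index_tuples n k"
  let ?\<Phi> = "\<Sum>i=1..n. x i powr (1 - s)"
  have "(\<Sum>J\<in>?T. \<Sum>i=1..n. average_at J x i powr (1 - s))
      \<le> (\<Sum>J\<in>?T. ?\<Phi> + (k powr s - 1) * (\<Sum>j\<in>set J. x j powr (1 - s)))"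
    by (intro sum_mono sum_average_at_powr_le) (use assms in auto)
  also have "\<dots> = card ?T * ?\<Phi> + (k powr s - 1) * (\<Sum>J\<in>?T. \<Sum>j\<in>set J. x j powr (1 - s))"
    by (simp add: sum.distrib sum_distrib_left)
  also have "(\<Sum>J\<in>?T. \<Sum>j\<in>set J. x j powr (1 - s)) = k / n * card ?T * ?\<Phi>"
    using sum_index_tuples_single[of n "\<lambda>i. x i powr (1 - s)" k] assms(1,2) by (simp add: field_simps)
  also have "card ?T * ?\<Phi> + (k powr s - 1) * (k / n * card ?T * ?\<Phi>)
      = (1 + k / n * (k powr s - 1)) * card ?T * ?\<Phi>"
    unfolding distrib_right by (simp only: mult_1 mult_ac)
  finally show ?thesis .
qed

section \<open>Tails of the l1 deviation\<close>

lemma l1_dist_uniform: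
  fixes x :: "nat \<Rightarrow> real"
  assumes "n > 0" and s: "0 < s" "s < 1"
    and nonneg: "\<And>i. i \<in> {1..n} \<Longrightarrow> x i \<ge> 0" and total: "(\<Sum>i=1..n. x i) = 1"
  shows "(\<Sum>i=1..n. \<bar>x i - 1 / n\<bar>) \<le> 2"
    and "2 - (\<Sum>i=1..n. \<bar>x i - 1 / n\<bar>) \<le> 2 * n powr (- s) * (\<Sum>i=1..n. x i powr (1 - s))"
proof -
  have "(\<Sum>i=1..n. \<bar>x i - 1 / n\<bar>) = (\<Sum>i=1..n. x i + 1 / n - 2 * min (x i) (1 / n))"
    by (intro sum.cong refl) (auto simp: min_def)
  also have "\<dots> = 2 - 2 * (\<Sum>i=1..n. min (x i) (1 / n))"
    using total \<open>n > 0\<close> by (simp add: sum_subtractf sum.distrib sum_distrib_left del: One_nat_def)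
  finally have eq: "(\<Sum>i=1..n. \<bar>x i - 1 / n\<bar>) = 2 - 2 * (\<Sum>i=1..n. min (x i) (1 / n))" .
  have "(\<Sum>i=1..n. min (x i) (1 / n)) \<ge> 0"
    using nonneg by (intro sum_nonneg) auto
  then show "(\<Sum>i=1..n. \<bar>x i - 1 / n\<bar>) \<le> 2"
    unfolding eq by simp
  have "(\<Sum>i=1..n. min (x i) (1 / n)) \<le> (\<Sum>i=1..n. n powr (- s) * x i powr (1 - s))"
  proof (rule sum_mono)
    fix i assume "i \<in> {1..n}"
    then have xi: "x i \<ge> 0" by (rule nonneg)
    define y where "y = min (x i) (1 / n)"
    have y: "y \<ge> 0" "y \<le> x i" "y \<le> 1 / n" using xi by (auto simp: y_def)
    have "y = y powr (1 - s) * y powr s"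
      using y(1) by (simp add: powr_add[symmetric])
    also have "\<dots> \<le> x i powr (1 - s) * (1 / n) powr s"
      using y s by (intro mult_mono powr_mono2) auto
    also have "\<dots> = n powr (- s) * x i powr (1 - s)"
      by (simp add: powr_divide powr_minus_divide)
    finally show "min (x i) (1 / n) \<le> n powr (- s) * x i powr (1 - s)"
      unfolding y_def .
  qed
  then show "2 - (\<Sum>i=1..n. \<bar>x i - 1 / n\<bar>) \<le> 2 * n powr (- s) * (\<Sum>i=1..n. x i powr (1 - s))"
    unfolding eq by (simp only: sum_distrib_left[symmetric])
qed

context k_averages_choices
begin

lemma prob_l1_deviation_large:
  assumes "2 \<le> k" "k \<le> n" "\<epsilon> > 0"
  shows "prob {\<omega>\<in>space M. \<bar>l1_deviation n x0 I m \<omega> - 0\<bar> > \<epsilon>}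
       \<le> (1 - (real k - 1) / (real n - 1)) ^ m
           * (n / \<epsilon>\<^sup>2 * (\<Sum>i=1..n. (x0 i - vec_mean n x0)\<^sup>2))"
proof -
  let ?\<mu> = "vec_mean n x0"
  let ?c = "1 - (real k - 1) / (real n - 1)"
  let ?F = "\<lambda>x. n / \<epsilon>\<^sup>2 * (\<Sum>i=1..n. (x i - ?\<mu>)\<^sup>2)"
  have "prob {\<omega>\<in>space M. \<bar>(\<Sum>i=1..n. \<bar>averages_chain x0 I m \<omega> i - ?\<mu>\<bar>) - 0\<bar> > \<epsilon>}
      \<le> ?c ^ m * ?F x0"
  proof (rule prob_chain_tail[where P="\<lambda>x. (\<Sum>i=1..n. x i) = n * ?\<mu>" and F="?F"
        and G="\<lambda>x. \<bar>(\<Sum>i=1..n. \<bar>x i - ?\<mu>\<bar>) - 0\<bar> > \<epsilon>"])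
    show "?c \<ge> 0" using assms by (simp add: divide_le_eq)
    show "(\<Sum>i=1..n. x0 i) = n * ?\<mu>"
      using assms by (simp add: vec_mean_def)
    show "(\<Sum>i=1..n. average_at J x i) = n * ?\<mu>"
      if "(\<Sum>i=1..n. x i) = n * ?\<mu>" "J \<in> index_tuples n k" for x J
      using sum_average_at_preserved[OF that(2), of x] that(1) assms by simp
    show "?F x \<ge> 0" for x by (simp add: sum_nonneg)
    show "(\<Sum>J\<in>index_tuples n k. ?F (average_at J x)) \<le> ?c * card (index_tuples n k) * ?F x"
      if "(\<Sum>i=1..n. x i) = n * ?\<mu>" for x
      unfolding sum_distrib_left[symmetric] sum_average_at_variance[OF assms(1,2) that]
      by (simp add: mult_ac)
    show "?F x \<ge> 1" if "\<bar>(\<Sum>i=1..n. \<bar>x i - ?\<mu>\<bar>) - 0\<bar> > \<epsilon>" for x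
    proof -
      have "\<epsilon>\<^sup>2 \<le> (\<Sum>i=1..n. \<bar>x i - ?\<mu>\<bar>)\<^sup>2"
        using that \<open>\<epsilon> > 0\<close> by (intro power_mono) (simp_all add: sum_nonneg)
      also have "\<dots> \<le> (\<Sum>i=1..n. \<bar>x i - ?\<mu>\<bar>\<^sup>2) * card {1..n}"
        by (rule sum_squared_le_sum_of_squares)
      finally have "\<epsilon>\<^sup>2 \<le> n * (\<Sum>i=1..n. (x i - ?\<mu>)\<^sup>2)"
        by (simp add: mult.commute)
      then show ?thesis
        using \<open>\<epsilon> > 0\<close> by (simp add: le_divide_eq)
    qed
  qed (use assms in simp)
  then show ?thesis
    by (simp only: l1_deviation_def)
qed

lemma prob_l1_deviation_not_near_two:
  assumes "2 \<le> k" "k \<le> n" "\<epsilon> > 0" and s: "0 < s" "s < 1"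
    and x0: "\<And>i. i \<in> {1..n} \<Longrightarrow> x0 i \<ge> 0" "(\<Sum>i=1..n. x0 i) = 1"
  shows "prob {\<omega>\<in>space M. \<bar>l1_deviation n x0 I m \<omega> - 2\<bar> > \<epsilon>}
       \<le> (1 + k / n * (k powr s - 1)) ^ m
           * (2 / \<epsilon> * n powr (- s) * (\<Sum>i=1..n. x0 i powr (1 - s)))"
proof -
  let ?c = "1 + k / n * (k powr s - 1)"
  let ?P = "\<lambda>x :: nat \<Rightarrow> real. (\<forall>i\<in>{1..n}. x i \<ge> 0) \<and> (\<Sum>i=1..n. x i) = 1"
  let ?F = "\<lambda>x :: nat \<Rightarrow> real. 2 / \<epsilon> * n powr (- s) * (\<Sum>i=1..n. x i powr (1 - s))"
  have mean: "vec_mean n x0 = 1 / n"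
    using x0(2) by (simp add: vec_mean_def)
  have "prob {\<omega>\<in>space M. \<bar>(\<Sum>i=1..n. \<bar>averages_chain x0 I m \<omega> i - 1 / n\<bar>) - 2\<bar> > \<epsilon>}
      \<le> ?c ^ m * ?F x0"
  proof (rule prob_chain_tail[where P="?P"])
    show "?c \<ge> 0" using assms by (simp add: ge_one_powr_ge_zero)
    show "?P x0" using x0 by simp
    show "?P (average_at J x)" if "?P x" "J \<in> index_tuples n k" for x J
    proof
      have "average_at J x i \<ge> 0" if "i \<in> {1..n}" for i
      proof -
        have "x j \<ge> 0" if "j \<in> set J" for j
          using \<open>?P x\<close> index_tuplesD(3)[OF \<open>J \<in> _\<close>] that by blast
        then show ?thesis
          using \<open>?P x\<close> that
          by (auto simp: average_at_def intro!: divide_nonneg_nonneg sum_list_nonneg)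
      qed
      then show "\<forall>i\<in>{1..n}. average_at J x i \<ge> 0" by blast
      show "(\<Sum>i=1..n. average_at J x i) = 1"
        using sum_average_at_preserved[OF that(2), of x] that(1) assms by simp
    qed
    show "?F x \<ge> 0" for x using \<open>\<epsilon> > 0\<close> by (simp add: sum_nonneg)
    show "(\<Sum>J\<in>index_tuples n k. ?F (average_at J x)) \<le> ?c * card (index_tuples n k) * ?F x"
      if "?P x" for x
    proof -
      have "(\<Sum>J\<in>index_tuples n k. ?F (average_at J x))
          \<le> 2 / \<epsilon> * n powr (- s) * (?c * card (index_tuples n k) * (\<Sum>i=1..n. x i powr (1 - s)))"
        unfolding sum_distrib_left[symmetric]
      proof (rule mult_left_mono)
        show "(\<Sum>J\<in>index_tuples n k. \<Sum>i=1..n. average_at J x i powr (1 - s))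
            \<le> ?c * card (index_tuples n k) * (\<Sum>i=1..n. x i powr (1 - s))"
          by (rule sum_average_at_powr_growth) (use assms(1,2) s that in \<open>simp_all del: One_nat_def\<close>)
      qed (use \<open>\<epsilon> > 0\<close> in simp)
      then show ?thesis by (simp only: mult_ac)
    qed
    show "?F x \<ge> 1" if "?P x" "\<bar>(\<Sum>i=1..n. \<bar>x i - 1 / n\<bar>) - 2\<bar> > \<epsilon>" for x
    proof -
      have "n > 0" using assms by simp
      have x: "\<And>i. i \<in> {1..n} \<Longrightarrow> x i \<ge> 0" "(\<Sum>i=1..n. x i) = 1"
        using that(1) by auto
      have "\<epsilon> \<le> 2 * n powr (- s) * (\<Sum>i=1..n. x i powr (1 - s))"
        using l1_dist_uniform[OF \<open>n > 0\<close> s x] that(2) by linarith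
      then show ?thesis
        using \<open>\<epsilon> > 0\<close> by (simp add: le_divide_eq)
    qed
  qed (use assms in simp)
  then show ?thesis
    by (simp only: l1_deviation_def mean)
qed

end

section \<open>The two phases\<close>

lemma tendsto_in_probI_powr:
  assumes "a < 0"
    and bound: "\<And>\<epsilon> n. \<epsilon> > 0 \<Longrightarrow> n \<ge> N \<Longrightarrow>
      measure (M n) {\<omega>\<in>space (M n). \<bar>X n \<omega> - c\<bar> > \<epsilon>} \<le> C \<epsilon> * real n powr a"
  shows "tendsto_in_prob M X c"
  unfolding tendsto_in_prob_def
proof (intro allI impI)
  fix \<epsilon> :: real assume "\<epsilon> > 0"
  have "(\<lambda>n. C \<epsilon> * real n powr a) \<longlonglongrightarrow> C \<epsilon> * 0"
    by (intro tendsto_mult tendsto_const tendsto_neg_powr \<open>a < 0\<close> filterlim_real_sequentially)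
  then have lim: "(\<lambda>n. C \<epsilon> * real n powr a) \<longlonglongrightarrow> 0" by simp
  show "(\<lambda>n. measure (M n) {\<omega>\<in>space (M n). \<bar>X n \<omega> - c\<bar> > \<epsilon>}) \<longlonglongrightarrow> 0"
  proof (rule tendsto_sandwich[OF _ _ tendsto_const lim])
    show "\<forall>\<^sub>F n in sequentially.
        measure (M n) {\<omega>\<in>space (M n). \<bar>X n \<omega> - c\<bar> > \<epsilon>} \<le> C \<epsilon> * real n powr a"
      using eventually_ge_at_top[of N] by eventually_elim (rule bound[OF \<open>\<epsilon> > 0\<close>])
  qed simp
qed

text \<open>
  At \<open>s = 0\<close> the two sides of the last inequality agree, and the derivative of \<open>s - \<theta> * k * (k powr s - 1)\<close>
  there is \<open>1 - \<theta> * k * ln k\<close>: this is where the threshold \<open>1 / (k * ln k)\<close> comes from.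
\<close>

lemma exists_powr_exponent:
  fixes k \<theta> :: real
  assumes "k > 1" "\<theta> < 1 / (k * ln k)"
  shows "\<exists>s. 0 < s \<and> s < 1 \<and> \<theta> * k * (k powr s - 1) < s"
proof -
  let ?g = "\<lambda>s. s - \<theta> * k * (k powr s - 1)"
  have "(?g has_real_derivative 1 - \<theta> * k * ln k) (at 0)"
    using assms(1) by (auto intro!: derivative_eq_intros)
  moreover have "1 - \<theta> * k * ln k > 0"
    using assms by (simp add: less_divide_eq mult.assoc)
  ultimately obtain d where d: "d > 0" "\<And>h. h > 0 \<Longrightarrow> h < d \<Longrightarrow> ?g 0 < ?g (0 + h)"
    using DERIV_pos_inc_right[of ?g "1 - \<theta> * k * ln k" 0] by blast
  define s where "s = min (d / 2) (1 / 2)"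
  have "0 < s" "s < d" "s < 1" using d(1) by (auto simp: s_def)
  with d(2)[of s] assms(1) show ?thesis by auto
qed

lemma first_unit_vec_properties:
  assumes "n \<ge> 1"
  shows "(\<Sum>i=1..n. first_unit_vec i) = 1"
    and "(\<Sum>i=1..n. first_unit_vec i powr p) = 1"
    and "(\<Sum>i=1..n. (first_unit_vec i - vec_mean n first_unit_vec)\<^sup>2) \<le> 1"
proof -
  have delta: "(\<Sum>i=1..n. if i = 1 then 1 else 0 :: real) = 1"
    using assms by (subst sum.delta) auto
  then show total: "(\<Sum>i=1..n. first_unit_vec i) = 1"
    by (simp add: first_unit_vec_def)
  have "first_unit_vec i powr p = (if i = 1 then 1 else 0)" for i
    by (simp add: first_unit_vec_def)
  then show "(\<Sum>i=1..n. first_unit_vec i powr p) = 1"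
    using delta by (simp only:)
  have "(first_unit_vec i - 1 / n)\<^sup>2 = (1 - 2 / n) * first_unit_vec i + (1 / n)\<^sup>2" for i
    by (simp add: first_unit_vec_def power2_eq_square algebra_simps)
  then have "(\<Sum>i=1..n. (first_unit_vec i - 1 / n)\<^sup>2) = (1 - 2 / n) * (\<Sum>i=1..n. first_unit_vec i) + n * (1 / n)\<^sup>2"
    by (simp only: sum.distrib sum_distrib_left[symmetric] sum_constant card_atLeastAtMost) simp
  then show "(\<Sum>i=1..n. (first_unit_vec i - vec_mean n first_unit_vec)\<^sup>2) \<le> 1"
    using assms by (simp add: vec_mean_def total power2_eq_square del: One_nat_def)
qed

theorem theorem1p1:
  fixes k :: nat
    and M :: "nat \<Rightarrow> 'a measure"
    and I :: "nat \<Rightarrow> nat \<Rightarrow> 'a \<Rightarrow> nat list"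
  assumes "k \<ge> 2"
    and "\<And>n. n \<ge> k \<Longrightarrow> k_averages_choices (M n) n k (I n)"
  shows "(\<forall>\<theta>::real. 0 \<le> \<theta> \<and> \<theta> < 1 / (real k * ln (real k)) \<longrightarrow>
           tendsto_in_prob M
             (\<lambda>n. l1_deviation n first_unit_vec (I n) (nat \<lfloor>\<theta> * real n * ln (real n)\<rfloor>)) 2)
       \<and> (\<forall>\<theta>::real. \<theta> > 1 / (real k - 1) \<longrightarrow>
           tendsto_in_prob M
             (\<lambda>n. l1_deviation n first_unit_vec (I n) (nat \<lfloor>\<theta> * real n * ln (real n)\<rfloor>)) 0)"
proof (intro conjI allI impI)
  fix \<theta> :: real
  assume \<theta>: "0 \<le> \<theta> \<and> \<theta> < 1 / (real k * ln (real k))"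
  obtain s where s: "0 < s" "s < 1" "\<theta> * k * (k powr s - 1) < s"
    using exists_powr_exponent[of "real k" \<theta>] \<theta> \<open>k \<ge> 2\<close> by auto
  let ?q = "k powr s - 1"
  have "?q \<ge> 0"
    using \<open>k \<ge> 2\<close> s by (simp add: ge_one_powr_ge_zero)
  show "tendsto_in_prob M
      (\<lambda>n. l1_deviation n first_unit_vec (I n) (nat \<lfloor>\<theta> * real n * ln (real n)\<rfloor>)) 2"
  proof (rule tendsto_in_probI_powr[where N=k and C="\<lambda>\<epsilon>. 2 / \<epsilon>" and a="\<theta> * k * ?q - s"])
    show "\<theta> * k * ?q - s < 0" using s by simp
    fix \<epsilon> :: real and n
    assume "\<epsilon> > 0" "n \<ge> k"
    interpret k_averages_choices "M n" n k "I n" using assms(2) \<open>n \<ge> k\<close> .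
    have n: "n \<ge> 1" "real n > 0" using \<open>k \<ge> 2\<close> \<open>n \<ge> k\<close> by auto
    define m where "m = nat \<lfloor>\<theta> * real n * ln (real n)\<rfloor>"
    have "real m \<le> \<theta> * n * ln n"
      using \<theta> n by (simp add: m_def)
    have "(1 + k / n * ?q) ^ m \<le> exp (k / n * ?q) ^ m"
      using \<open>?q \<ge> 0\<close> by (intro power_mono exp_ge_add_one_self) simp
    also have "\<dots> = exp (k / n * ?q * m)"
      by (simp add: exp_of_nat_mult[symmetric] mult.commute)
    also have "\<dots> \<le> exp (k / n * ?q * (\<theta> * n * ln n))"
      unfolding exp_le_cancel_iff using \<open>?q \<ge> 0\<close> \<open>real m \<le> _\<close> by (intro mult_left_mono) auto
    also have "\<dots> = n powr (\<theta> * k * ?q)"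
      using n by (simp add: powr_def field_simps)
    finally have growth: "(1 + k / n * ?q) ^ m \<le> n powr (\<theta> * k * ?q)" .
    have "prob {\<omega>\<in>space (M n). \<bar>l1_deviation n first_unit_vec (I n) m \<omega> - 2\<bar> > \<epsilon>}
        \<le> (1 + k / n * ?q) ^ m * (2 / \<epsilon> * n powr (- s) * (\<Sum>i=1..n. first_unit_vec i powr (1 - s)))"
      by (rule prob_l1_deviation_not_near_two)
         (use assms(1) \<open>n \<ge> k\<close> \<open>\<epsilon> > 0\<close> s first_unit_vec_properties(1)[OF n(1)]
           in \<open>auto simp: first_unit_vec_def\<close>)
    also have "\<dots> = (1 + k / n * ?q) ^ m * (2 / \<epsilon> * n powr (- s))"
      by (simp only: first_unit_vec_properties(2)[OF n(1)] mult_1_right)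
    also have "\<dots> \<le> n powr (\<theta> * k * ?q) * (2 / \<epsilon> * n powr (- s))"
      using growth \<open>\<epsilon> > 0\<close> by (intro mult_right_mono) auto
    also have "\<dots> = 2 / \<epsilon> * n powr (\<theta> * k * ?q - s)"
      using powr_add[of n "\<theta> * k * ?q" "- s"] by simp
    finally show "prob {\<omega>\<in>space (M n).
        \<bar>l1_deviation n first_unit_vec (I n) (nat \<lfloor>\<theta> * real n * ln (real n)\<rfloor>) \<omega> - 2\<bar> > \<epsilon>}
        \<le> 2 / \<epsilon> * n powr (\<theta> * k * ?q - s)"
      unfolding m_def .
  qed
next
  fix \<theta> :: real
  assume \<theta>: "\<theta> > 1 / (real k - 1)"
  have k: "real k - 1 > 0" using \<open>k \<ge> 2\<close> by simp
  show "tendsto_in_prob M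
      (\<lambda>n. l1_deviation n first_unit_vec (I n) (nat \<lfloor>\<theta> * real n * ln (real n)\<rfloor>)) 0"
  proof (rule tendsto_in_probI_powr[where N=k and C="\<lambda>\<epsilon>. exp (real k - 1) / \<epsilon>\<^sup>2"
        and a="1 - (real k - 1) * \<theta>"])
    show "1 - (real k - 1) * \<theta> < 0"
      using \<theta> k by (simp add: divide_less_eq mult.commute)
    fix \<epsilon> :: real and n
    assume "\<epsilon> > 0" "n \<ge> k"
    interpret k_averages_choices "M n" n k "I n" using assms(2) \<open>n \<ge> k\<close> .
    have n: "n \<ge> 1" "real n > 1" using \<open>k \<ge> 2\<close> \<open>n \<ge> k\<close> by auto
    define m where "m = nat \<lfloor>\<theta> * real n * ln (real n)\<rfloor>"
    have m: "real m \<ge> \<theta> * n * ln n - 1"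
      unfolding m_def by linarith
    define r where "r = (real k - 1) / (real n - 1)"
    have r: "(real k - 1) / n \<le> r" "r \<le> 1"
      using k n \<open>n \<ge> k\<close> by (auto simp: r_def intro!: divide_left_mono)
    have "(1 - r) ^ m \<le> exp (- r) ^ m"
      using r exp_ge_add_one_self[of "- r"] by (intro power_mono) auto
    also have "\<dots> = exp (- (r * m))"
      by (simp add: exp_of_nat_mult[symmetric] mult.commute)
    (* The floor in m costs at most the factor exp ((k - 1) / n), which the constant exp (k - 1) absorbs. *)
    also have "r * m \<ge> (real k - 1) / n * (\<theta> * n * ln n - 1)"
    proof -
      have "(real k - 1) / n * (\<theta> * n * ln n - 1) \<le> (real k - 1) / n * m"
        using m k n by (intro mult_left_mono) auto
      also have "\<dots> \<le> r * m"
        using r by (intro mult_right_mono) auto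
      finally show ?thesis .
    qed
    then have "exp (- (r * m)) \<le> exp (- ((real k - 1) / n * (\<theta> * n * ln n - 1)))"
      by simp
    also have "(real k - 1) / n * (\<theta> * n * ln n - 1) = (real k - 1) * \<theta> * ln n - (real k - 1) / n"
      using n by (simp add: field_simps)
    also have "exp (- ((real k - 1) * \<theta> * ln n - (real k - 1) / n))
        \<le> exp (real k - 1 - (real k - 1) * \<theta> * ln n)"
      using k n by (simp add: divide_le_eq)
    also have "\<dots> = exp (real k - 1) * n powr (- ((real k - 1) * \<theta>))"
      using n by (simp add: powr_def mult_exp_exp)
    finally have decay: "(1 - r) ^ m \<le> exp (real k - 1) * n powr (- ((real k - 1) * \<theta>))" .
    have "prob {\<omega>\<in>space (M n). \<bar>l1_deviation n first_unit_vec (I n) m \<omega> - 0\<bar> > \<epsilon>}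
        \<le> (1 - r) ^ m * (n / \<epsilon>\<^sup>2 * (\<Sum>i=1..n. (first_unit_vec i - vec_mean n first_unit_vec)\<^sup>2))"
      unfolding r_def by (rule prob_l1_deviation_large) (use assms(1) \<open>n \<ge> k\<close> \<open>\<epsilon> > 0\<close> in auto)
    also have "\<dots> \<le> (1 - r) ^ m * (n / \<epsilon>\<^sup>2 * 1)"
      using r first_unit_vec_properties(3)[OF n(1)] by (intro mult_left_mono) auto
    also have "\<dots> \<le> (exp (real k - 1) * n powr (- ((real k - 1) * \<theta>))) * (n / \<epsilon>\<^sup>2 * 1)"
      using decay by (intro mult_right_mono) auto
    also have "\<dots> = exp (real k - 1) / \<epsilon>\<^sup>2 * n powr (1 - (real k - 1) * \<theta>)"
      using powr_mult_base[of n "- ((real k - 1) * \<theta>)"] by (simp add: mult.commute)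
    finally show "prob {\<omega>\<in>space (M n).
        \<bar>l1_deviation n first_unit_vec (I n) (nat \<lfloor>\<theta> * real n * ln (real n)\<rfloor>) \<omega> - 0\<bar> > \<epsilon>}
        \<le> exp (real k - 1) / \<epsilon>\<^sup>2 * n powr (1 - (real k - 1) * \<theta>)"
      unfolding m_def .
  qed
qed

end
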